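(* Let $\beta$ be the tribonacci number, i.e. the unique root in $(1,2)$ of $x^3=x^2+x+1$. Then $S_\beta(1)=0$, $S_\beta(3)=[(001)^\infty]_\beta$, $S_\beta(4)=[(0011)^\infty]_\beta$, $S_\beta(6)=[(001101)^\infty]_\beta$, and $$S_\beta(p)=\begin{cases} [(01(011)^m)^\infty]_\beta, & p=3m+2,\ m\ge 0,\\ [(01(011)^{z-1}01(011)^z)^\infty]_\beta, & p=3m+1,\ m=2z,\ z\ge 1,\\ [(01(011)^{z-1}01(011)^{z+1})^\infty]_\beta, & p=3m+1,\ m=2z+1,\ z\ge 1,\\ [(01(011)^{z-1}01(011)^{z-1}01(011)^z)^\infty]_\beta, & p=3m,\ m=3z,\ z\ge 1,\\ [(01(011)^{z-1}01(011)^{z}01(011)^z)^\infty]_\beta, & p=3m,\ m=3z+1,\ z\ge 1,\\ [(01(011)^{z-1}01(011)^{z+1}01(011)^z)^\infty]_\beta, & p=3m,\ m=3z+2,\ z\ge 1, \end{cases}$$ where $m,z$ denote integers.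
   Context: For $\beta\in(1,2]$ let $T_\beta:[0,1)\to[0,1)$, $T_\beta(x)=\beta x \pmod 1$. For $t\in[0,1)$ the survivor set is $K_\beta(t)=\{x\in[0,1): T_\beta^n(x)\ge t \text{ for all } n\ge 0\}$. A point $x$ has smallest period $p$ if $T_\beta^p(x)=x$ and $T_\beta^j(x)\ne x$ for all $1\le j<p$. For a positive integer $p$, $$S_\beta(p)=\sup\{t\in[0,1): K_\beta(t)\text{ contains a point of smallest period } p\}.$$ For a sequence $(x_i)_{i\ge1}\in\{0,1\}^{\mathbb N}$ write $[(x_1x_2x_3\cdots)]_\beta=\sum_{i\ge1}x_i\beta^{-i}$. For a finite word $w$ over $\{0,1\}$, $w^k$ is the $k$-fold concatenation of $w$ with itself ($w^0$ is the empty word) and $w^\infty$ is the infinite periodic sequence $www\cdots$. *)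

theory Defs
  imports "HOL-Analysis.Analysis"
begin

definition beta_map :: "real \<Rightarrow> real \<Rightarrow> real" where
  "beta_map \<beta> x = frac (\<beta> * x)"

definition survivor_set :: "real \<Rightarrow> real \<Rightarrow> real set" where
  "survivor_set \<beta> t = {x \<in> {0..<1}. \<forall>n. (beta_map \<beta> ^^ n) x \<ge> t}"

definition smallest_period :: "real \<Rightarrow> real \<Rightarrow> nat \<Rightarrow> bool" where
  "smallest_period \<beta> x p \<longleftrightarrow>
     0 < p \<and> (beta_map \<beta> ^^ p) x = x \<and> (\<forall>j. 1 \<le> j \<and> j < p \<longrightarrow> (beta_map \<beta> ^^ j) x \<noteq> x)"

definition S :: "real \<Rightarrow> nat \<Rightarrow> real" where
  "S \<beta> p = Sup {t \<in> {0..<1}. \<exists>x \<in> survivor_set \<beta> t. smallest_period \<beta> x p}"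

(* Sequences are indexed from 0 here: x i is the digit of weight \<beta>^-(i+1). *)
definition beta_value :: "real \<Rightarrow> (nat \<Rightarrow> nat) \<Rightarrow> real" where
  "beta_value \<beta> x = (\<Sum>i. real (x i) / \<beta> ^ Suc i)"

definition word_power :: "nat list \<Rightarrow> nat \<Rightarrow> nat list" where
  "word_power w k = concat (replicate k w)"

(* The infinite word www...; only meaningful for nonempty w. *)
definition periodic_word :: "nat list \<Rightarrow> nat \<Rightarrow> nat" where
  "periodic_word w i = w ! (i mod length w)"

definition tribonacci_number :: real where
  "tribonacci_number = (THE x. 1 < x \<and> x < 2 \<and> x ^ 3 = x ^ 2 + x + 1)"

end

theory Submission
  imports Defs
begin

text \<open>Write \<open>q = 1 / \<beta>\<close>, so \<open>q + q^2 + q^3 = 1\<close> and no expansion of a point of \<open>[0, 1)\<close> contains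
  \<open>111\<close>.  The supremum \<open>S \<beta> p\<close> is the largest possible minimum of an orbit of exact period \<open>p\<close>
  (\<open>S_eqI\<close>), so the task is to maximize the least rotation of a periodic word.

  A word with \<open>00\<close> has a rotation below \<open>q^2\<close>, the least point whose expansion starts with \<open>01\<close>.
  So a good orbit avoids \<open>00\<close>, and then its word is a concatenation of the blocks \<open>01\<close> and \<open>011\<close>.
  The block \<open>01\<close> must occur, because \<open>(011)^\<infinity>\<close> is not the expansion of a point
  (\<open>short_block_occurs\<close>).  Hence the orbit is given by the cyclic list of gaps, the numbers of
  blocks \<open>011\<close> between consecutive blocks \<open>01\<close> (\<open>gap_list_exists\<close>), and points that start with
  \<open>01\<close> are ordered as their gap lists are lexicographically (\<open>lex_less\<close>).

  With \<open>k\<close> gaps of sum \<open>l\<close> the period is \<open>p = 2 k + 3 l\<close>.  To make the least rotation large, the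
  least gap should be large, that is, \<open>k\<close> small and the gaps balanced.  The residue of \<open>p\<close> modulo
  \<open>3\<close> determines the residue of \<open>k\<close>, so the best \<open>k\<close> is \<open>1\<close>, \<open>2\<close> or \<open>3\<close> (\<open>gap_count\<close>).  Two or
  more equal gaps are excluded since they lower the exact period.  What remains is the best
  non-constant distribution, which depends on the residue of the number of long blocks modulo
  \<open>k\<close>: that is where the case distinctions of the theorem come from.

  For the periods \<open>3\<close>, \<open>4\<close>, \<open>6\<close> every gap list is constant with at least two entries, if there
  is one at all, so \<open>00\<close> is unavoidable (\<open>S_exceptional\<close>).\<close>

lemma funpow_funpow: "(f ^^ m) ((f ^^ n) x) = (f ^^ (m + n)) x"
  by (simp add: funpow_add)

lemma word_power_0: "word_power w 0 = []"
  by (simp add: word_power_def)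

lemma word_power_Suc: "word_power w (Suc k) = w @ word_power w k"
  by (simp add: word_power_def)

lemma sum_list_ge_length_mult:
  fixes gs :: "nat list"
  assumes "\<forall>g\<in>set gs. h \<le> g"
  shows "length gs * h \<le> sum_list gs"
  using assms by (induction gs) auto

section \<open>Survivor sets and periodic orbits\<close>

lemma beta_map_range: "0 \<le> beta_map \<beta> y" "beta_map \<beta> y < 1"
  by (simp_all add: beta_map_def frac_lt_1)

lemma funpow_beta_map_range:
  assumes "0 \<le> x" "x < 1"
  shows "0 \<le> (beta_map \<beta> ^^ n) x" "(beta_map \<beta> ^^ n) x < 1"
  using assms by (cases n; simp add: beta_map_range)+

text \<open>A periodic orbit survives exactly the thresholds up to its least element.  So the supremum is
  attained at the least element of the best orbit, which is why a single point \<open>t\<close> that is the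
  strict minimum of its own orbit can serve as a witness for both the value and the exact period.\<close>

lemma S_eqI:
  assumes p: "0 < p" and t: "0 \<le> t" "t < 1"
    and per: "(beta_map \<beta> ^^ p) t = t"
    and min: "\<And>j. 0 < j \<Longrightarrow> j < p \<Longrightarrow> t < (beta_map \<beta> ^^ j) t"
    and upper: "\<And>x. 0 \<le> x \<Longrightarrow> x < 1 \<Longrightarrow> smallest_period \<beta> x p \<Longrightarrow> \<exists>n. (beta_map \<beta> ^^ n) x \<le> t"
  shows "S \<beta> p = t"
proof -
  have "t \<le> (beta_map \<beta> ^^ n) t" for n
  proof -
    have "(beta_map \<beta> ^^ n) t = (beta_map \<beta> ^^ (n mod p)) t"
      by (rule funpow_mod_eq[OF per, symmetric])
    moreover have "n mod p < p" using p by simp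
    ultimately show ?thesis
      using min[of "n mod p"] by (cases "n mod p = 0") (simp_all add: less_imp_le)
  qed
  then have surv: "t \<in> survivor_set \<beta> t"
    using t by (simp add: survivor_set_def)
  have sp: "smallest_period \<beta> t p"
    unfolding smallest_period_def
  proof (intro conjI allI impI)
    show "(beta_map \<beta> ^^ j) t \<noteq> t" if "1 \<le> j \<and> j < p" for j
      using min[of j] that by simp
  qed (use p per in auto)
  show ?thesis
    unfolding S_def
  proof (rule cSup_eq_maximum)
    show "t \<in> {t \<in> {0..<1}. \<exists>x\<in>survivor_set \<beta> t. smallest_period \<beta> x p}"
      using t surv sp by auto
  next
    fix s assume "s \<in> {t \<in> {0..<1}. \<exists>x\<in>survivor_set \<beta> t. smallest_period \<beta> x p}"
    then obtain x where x: "x \<in> survivor_set \<beta> s" "smallest_period \<beta> x p" by auto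
    then obtain n where "(beta_map \<beta> ^^ n) x \<le> t"
      using upper[of x] by (auto simp: survivor_set_def)
    moreover have "s \<le> (beta_map \<beta> ^^ n) x"
      using x by (auto simp: survivor_set_def)
    ultimately show "s \<le> t" by simp
  qed
qed

lemma survivor_set_funpow:
  assumes "x \<in> survivor_set \<beta> t"
  shows "(beta_map \<beta> ^^ n) x \<in> survivor_set \<beta> t"
proof -
  have "t \<le> (beta_map \<beta> ^^ k) ((beta_map \<beta> ^^ n) x)" for k
    using assms by (auto simp: survivor_set_def funpow_funpow)
  then show ?thesis
    using assms funpow_beta_map_range[where x = x and n = n and \<beta> = \<beta>] by (auto simp: survivor_set_def)
qed

lemma smallest_period_funpow:
  assumes "smallest_period \<beta> x p"
  shows "smallest_period \<beta> ((beta_map \<beta> ^^ n) x) p"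
proof -
  let ?T = "beta_map \<beta>"
  have p: "0 < p" and per: "(?T ^^ p) x = x"
    using assms by (auto simp: smallest_period_def)
  have "(?T ^^ p) ((?T ^^ n) x) = (?T ^^ n) ((?T ^^ p) x)"
    by (simp only: funpow_funpow ac_simps)
  then have "(?T ^^ p) ((?T ^^ n) x) = (?T ^^ n) x"
    by (simp add: per)
  moreover have "(?T ^^ j) ((?T ^^ n) x) \<noteq> (?T ^^ n) x" if j: "1 \<le> j" "j < p" for j
  proof
    \<comment> \<open>\<open>T\<close> need not be injective; moving on by \<open>p * n - n\<close> more steps brings the orbit back to \<open>x\<close>.\<close>
    assume eq: "(?T ^^ j) ((?T ^^ n) x) = (?T ^^ n) x"
    have ret: "(?T ^^ (p * n - n)) ((?T ^^ n) x) = x"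
    proof -
      have "(?T ^^ (p * n - n)) ((?T ^^ n) x) = (?T ^^ (p * n)) x"
        using p by (simp add: funpow_funpow)
      also have "\<dots> = (?T ^^ (p * n mod p)) x"
        by (rule funpow_mod_eq[OF per, symmetric])
      finally show ?thesis by simp
    qed
    have "(?T ^^ j) x = (?T ^^ j) ((?T ^^ (p * n - n)) ((?T ^^ n) x))"
      by (simp add: ret)
    also have "\<dots> = (?T ^^ (p * n - n)) ((?T ^^ j) ((?T ^^ n) x))"
      by (simp only: funpow_funpow ac_simps)
    also have "\<dots> = x"
      by (simp add: eq ret)
    finally show False
      using assms j by (auto simp: smallest_period_def)
  qed
  ultimately show ?thesis
    using p by (simp add: smallest_period_def)
qed

section \<open>Prepending digits\<close>

locale tribonacci =
  fixes \<beta> :: real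
  assumes one_less: "1 < \<beta>" and cubic: "\<beta> ^ 3 = \<beta> ^ 2 + \<beta> + 1"
begin

abbreviation T :: "real \<Rightarrow> real" where
  "T \<equiv> beta_map \<beta>"

definition q :: real where
  "q = 1 / \<beta>"

lemma q_sum: "q + q^2 + q^3 = 1"
proof -
  have "\<beta> \<noteq> 0" using one_less by simp
  then have "q + q^2 + q^3 = (\<beta>^2 + \<beta> + 1) / \<beta>^3"
    by (simp add: q_def field_simps power2_eq_square power3_eq_cube)
  also have "\<dots> = 1"
    unfolding cubic[symmetric] using \<open>\<beta> \<noteq> 0\<close> by simp
  finally show ?thesis .
qed

lemma q_less_1: "q < 1"
  using one_less by (simp add: q_def)

lemma q_pos: "0 < q"
  using one_less by (simp add: q_def)

lemma beta_q: "\<beta> * q = 1"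
  using one_less by (simp add: q_def)

text \<open>As \<open>q^2 + q^3\<close> is the value of the digits \<open>011\<close>, the number \<open>1 - q\<close> is the left endpoint of
  the points whose expansion starts with \<open>011\<close>.  Below, \<open>1 - q\<close> separates the two kinds of block.\<close>

lemma one_minus_q: "1 - q = q^2 + q^3"
  using q_sum by simp

lemma q_gt_half: "1/2 < q"
proof (rule ccontr)
  assume "\<not> 1/2 < q"
  then have "q \<le> 1/2" by simp
  moreover from this have "q^2 \<le> (1/2)^2" "q^3 \<le> (1/2)^3"
    using q_pos by (intro power_mono; simp)+
  ultimately have "q + q^2 + q^3 \<le> 7/8"
    by (simp add: power2_eq_square power3_eq_cube)
  then show False using q_sum by simp
qed

lemma q2_bounds: "0 < q^2" "q^2 < 1 - q"
  using q_pos by (simp_all add: one_minus_q)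

lemma q2_less_q: "q^2 < q"
  using q2_bounds(2) q_gt_half by linarith

definition prepend :: "nat list \<Rightarrow> real \<Rightarrow> real" where
  "prepend w y = foldr (\<lambda>d u. q * (real d + u)) w y"

lemma prepend_simps [simp]:
  "prepend [] y = y"
  "prepend (d # w) y = q * (real d + prepend w y)"
  by (simp_all add: prepend_def)

lemma prepend_append: "prepend (u @ v) y = prepend u (prepend v y)"
  by (simp add: prepend_def)

lemma prepend_diff: "prepend w y - prepend w z = q ^ length w * (y - z)"
proof (induction w)
  case (Cons d w)
  have "prepend (d # w) y - prepend (d # w) z = q * (prepend w y - prepend w z)"
    by (simp add: algebra_simps)
  then show ?case by (simp add: Cons)
qed simp

lemma prepend_less_iff: "prepend w y < prepend w z \<longleftrightarrow> y < z"
proof -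
  have "prepend w z - prepend w y = q ^ length w * (z - y)"
    by (rule prepend_diff)
  moreover have "0 < q ^ length w * (z - y) \<longleftrightarrow> y < z"
    using q_pos by (simp add: zero_less_mult_iff)
  ultimately show ?thesis by linarith
qed

lemma power_q_less_1: "w \<noteq> [] \<Longrightarrow> q ^ length w < 1"
  using q_pos q_less_1 power_less_one_iff[of q "length w"] by simp

text \<open>Prepending a nonempty word is an increasing contraction, hence a point lies on the same side
  of the fixed point as it does of its image.\<close>

lemma le_fixpoint:
  assumes "w \<noteq> []" "prepend w t = t" "y \<le> prepend w y"
  shows "y \<le> t"
proof (rule ccontr)
  assume "\<not> y \<le> t"
  then have "q ^ length w * (y - t) < 1 * (y - t)"
    using power_q_less_1[OF assms(1)] by (intro mult_strict_right_mono) auto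
  then show False
    using prepend_diff[of w y t] assms by simp
qed

lemma fixpoint_le:
  assumes "w \<noteq> []" "prepend w t = t" "prepend w y \<le> y"
  shows "t \<le> y"
proof (rule ccontr)
  assume "\<not> t \<le> y"
  then have "q ^ length w * (t - y) < 1 * (t - y)"
    using power_q_less_1[OF assms(1)] by (intro mult_strict_right_mono) auto
  then show False
    using prepend_diff[of w t y] assms by simp
qed

lemma fixpoint_unique:
  assumes "w \<noteq> []" "prepend w t = t" "prepend w y = y"
  shows "y = t"
  using le_fixpoint[of w t y] fixpoint_le[of w t y] assms by auto

lemma T_prepend_digit: "0 \<le> y \<Longrightarrow> y < 1 \<Longrightarrow> T (q * (real d + y)) = y"
proof -
  assume y: "0 \<le> y" "y < 1"
  have "\<beta> * (q * (real d + y)) = (\<beta> * q) * (real d + y)" by (rule mult.assoc[symmetric])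
  then have "\<beta> * (q * (real d + y)) = real d + y"
    by (simp only: beta_q mult_1)
  then show ?thesis
    using y unfolding beta_map_def by (simp only: frac_unique_iff) simp
qed

lemma digit_0:
  assumes "0 \<le> y" "y < q"
  shows "y = q * T y"
proof -
  have eq: "y = q * (\<beta> * y)" using beta_q by (simp add: mult.commute mult.left_commute)
  have "\<beta> * y < 1"
    using assms one_less by (simp add: q_def field_simps)
  moreover have "0 \<le> \<beta> * y" using assms one_less by simp
  ultimately have "T y = \<beta> * y"
    by (simp add: beta_map_def frac_eq)
  then show ?thesis using eq by simp
qed

lemma digit_1:
  assumes "q \<le> y" "y < 1"
  shows "y = q * (1 + T y)"
proof -
  have eq: "y = q * (\<beta> * y)" using beta_q by (simp add: mult.commute mult.left_commute)
  have "1 \<le> \<beta> * y"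
    using assms one_less by (simp add: q_def field_simps)
  moreover have "\<beta> * y < 2"
  proof -
    have "\<beta> * y < \<beta>" using assms one_less by simp
    moreover have "\<beta> < 2" using q_gt_half one_less by (simp add: q_def field_simps)
    ultimately show ?thesis by simp
  qed
  ultimately have "frac (\<beta> * y) = \<beta> * y - 1"
    by (simp add: frac_unique_iff)
  then show ?thesis using eq by (simp add: beta_map_def)
qed

lemma le_prepend_1:
  assumes "0 \<le> y" "y < 1"
  shows "y \<le> q * (1 + T y)"
proof (cases "y < q")
  case True
  have "q * T y \<le> q * (1 + T y)" using q_pos by simp
  then show ?thesis using digit_0[OF assms(1) True] by linarith
next
  case False
  then show ?thesis using digit_1[of y] assms by simp
qed

lemma beta_value_split:
  assumes "\<And>i. x i \<le> (1::nat)"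
  shows "beta_value \<beta> x = prepend (map x [0..<n]) (beta_value \<beta> (\<lambda>i. x (i + n)))"
  using assms
proof (induction n arbitrary: x)
  case (Suc n)
  have summ: "summable (\<lambda>i. real (y i) / \<beta> ^ Suc i)" if "\<And>i. y i \<le> (1::nat)" for y
  proof (rule summable_comparison_test)
    show "\<exists>N. \<forall>n\<ge>N. norm (real (y n) / \<beta> ^ Suc n) \<le> q ^ n"
    proof (intro exI[of _ 0] allI impI)
      fix n
      have "real (y n) / \<beta> ^ Suc n \<le> 1 / \<beta> ^ n"
        using that[of n] one_less
        by (intro frac_le) (auto intro: order_trans[of _ "\<beta> ^ n * 1"])
      then show "norm (real (y n) / \<beta> ^ Suc n) \<le> q ^ n"
        using one_less by (simp add: q_def power_divide)
    qed
    show "summable (\<lambda>n. q ^ n)"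
      using q_pos q_less_1 by (intro summable_geometric) simp
  qed
  have "beta_value \<beta> x = real (x 0) / \<beta> + (\<Sum>i. real (x (Suc i)) / \<beta> ^ Suc (Suc i))"
    unfolding beta_value_def using suminf_split_head[OF summ[of x, OF Suc.prems]]
    by (simp only: power_Suc power_0 mult_1_right)
  also have "(\<Sum>i. real (x (Suc i)) / \<beta> ^ Suc (Suc i))
      = (\<Sum>i. q * (real (x (Suc i)) / \<beta> ^ Suc i))"
    by (simp add: q_def)
  also have "\<dots> = q * beta_value \<beta> (\<lambda>i. x (Suc i))"
    unfolding beta_value_def using summ[of "\<lambda>i. x (Suc i)"] Suc.prems
    by (intro suminf_mult) auto
  finally have "beta_value \<beta> x = q * (real (x 0) + beta_value \<beta> (\<lambda>i. x (Suc i)))"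
    by (simp add: q_def add_divide_distrib)
  also have "beta_value \<beta> (\<lambda>i. x (Suc i))
      = prepend (map (\<lambda>i. x (Suc i)) [0..<n]) (beta_value \<beta> (\<lambda>i. x (Suc (i + n))))"
    using Suc.IH[of "\<lambda>i. x (Suc i)"] Suc.prems by simp
  also have "map (\<lambda>i. x (Suc i)) [0..<n] = map x [Suc 0..<Suc n]"
    by (simp only: map_Suc_upt[symmetric] map_map comp_def)
  finally show ?case
    by (simp add: upt_conv_Cons del: upt_Suc)
qed simp

lemma beta_value_periodic:
  assumes "w \<noteq> []" "set w \<subseteq> {0,1}"
  shows "prepend w (beta_value \<beta> (periodic_word w)) = beta_value \<beta> (periodic_word w)"
proof -
  have "periodic_word w i \<le> 1" for i
  proof -
    have "periodic_word w i \<in> set w"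
      using assms(1) by (simp add: periodic_word_def)
    then show ?thesis using assms(2) by auto
  qed
  moreover have "map (periodic_word w) [0..<length w] = w"
    by (rule nth_equalityI) (simp_all add: periodic_word_def)
  moreover have "(\<lambda>i. periodic_word w (i + length w)) = periodic_word w"
    by (simp add: periodic_word_def fun_eq_iff)
  ultimately show ?thesis
    using beta_value_split[of "periodic_word w" "length w"] by simp
qed

section \<open>Blocks and gap lists\<close>

definition short :: "real \<Rightarrow> real" where
  "short = prepend [0,1]"

definition long :: "real \<Rightarrow> real" where
  "long = prepend [0,1,1]"

lemma short_eq: "short y = q^2 + q^2 * y"
  by (simp add: short_def power2_eq_square algebra_simps)

lemma long_eq: "long y = (1 - q) + q^3 * y"
  unfolding one_minus_q by (simp add: long_def power2_eq_square power3_eq_cube algebra_simps)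

lemma short_range:
  assumes "0 \<le> y" "y < q"
  shows "q^2 \<le> short y" "short y < 1 - q"
proof -
  show "q^2 \<le> short y" using assms by (simp add: short_eq)
  have "q^2 * y < q^2 * q"
    using assms q_pos by (intro mult_strict_left_mono) auto
  then show "short y < 1 - q"
    by (simp add: short_eq one_minus_q power2_eq_square power3_eq_cube)
qed

lemma long_q: "long q = q"
proof -
  have "long q = q * (q + q^2 + q^3)"
    unfolding long_eq one_minus_q by (simp add: power2_eq_square power3_eq_cube algebra_simps)
  then show ?thesis by (simp add: q_sum)
qed

lemma long_range:
  assumes "0 \<le> y" "y < q"
  shows "1 - q \<le> long y" "long y < q"
proof -
  show "1 - q \<le> long y" using assms q_pos by (simp add: long_eq)
  have "long y < long q"
    unfolding long_def by (simp only: prepend_less_iff assms)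
  also have "long q = q" by (rule long_q)
  finally show "long y < q" .
qed

lemma long_pow_range:
  assumes "0 \<le> y" "y < q"
  shows "0 \<le> (long ^^ g) y" "(long ^^ g) y < q" "0 < g \<Longrightarrow> 1 - q \<le> (long ^^ g) y"
proof -
  have *: "0 \<le> (long ^^ g) y \<and> (long ^^ g) y < q" for g
  proof (induction g)
    case (Suc g)
    then show ?case
      using long_range[of "(long ^^ g) y"] q_less_1 by auto
  qed (use assms in auto)
  show "0 \<le> (long ^^ g) y" "(long ^^ g) y < q" using * by auto
  assume "0 < g"
  then obtain k where "g = Suc k" by (cases g) auto
  then show "1 - q \<le> (long ^^ g) y"
    using long_range[of "(long ^^ k) y"] *[of k] by simp
qed

text \<open>A periodic word without \<open>00\<close> and \<open>111\<close> that starts with the block \<open>01\<close> is determined by its gaps, the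
  numbers of blocks \<open>011\<close> after each block \<open>01\<close>.\<close>

definition spell :: "nat list \<Rightarrow> nat list" where
  "spell gs = concat (map (\<lambda>g. [0,1] @ word_power [0,1,1] g) gs)"

abbreviation code :: "nat list \<Rightarrow> real \<Rightarrow> real" where
  "code gs \<equiv> prepend (spell gs)"

lemma prepend_word_power: "prepend (word_power [0,1,1] g) y = (long ^^ g) y"
proof (induction g)
  case (Suc g)
  have "prepend (word_power [0,1,1] (Suc g)) y = long (prepend (word_power [0,1,1] g) y)"
    unfolding word_power_Suc prepend_append long_def ..
  then show ?case unfolding Suc by simp
qed (simp add: word_power_0)

lemma code_Nil [simp]: "code [] y = y"
  by (simp add: spell_def)

lemma code_Cons: "code (g # gs) y = short ((long ^^ g) (code gs y))"
proof -
  have "spell (g # gs) = [0,1] @ word_power [0,1,1] g @ spell gs"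
    by (simp add: spell_def)
  then show ?thesis
    by (simp only: prepend_append prepend_word_power short_def)
qed

lemma code_append: "code (us @ vs) y = code us (code vs y)"
  by (simp add: spell_def prepend_append)

lemma length_spell: "length (spell gs) = 2 * length gs + 3 * sum_list gs"
proof (induction gs)
  case (Cons g gs)
  have "length (word_power [0,1,1::nat] g) = 3 * g"
    by (induction g) (simp_all add: word_power_0 word_power_Suc)
  then show ?case using Cons by (simp add: spell_def)
qed (simp add: spell_def)

lemma spell_eq_Nil_iff: "spell gs = [] \<longleftrightarrow> gs = []"
  by (cases gs) (simp_all add: spell_def)

lemma set_spell: "set (spell gs) \<subseteq> {0,1}"
proof -
  have "set (word_power [0,1,1::nat] g) \<subseteq> {0,1}" for g
    by (auto simp: word_power_def)
  then show ?thesis by (auto simp: spell_def)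
qed

lemma code_range:
  assumes "gs \<noteq> []" "0 \<le> y" "y < q"
  shows "q^2 \<le> code gs y" "code gs y < 1 - q"
proof -
  have "q^2 \<le> code gs y \<and> code gs y < 1 - q"
    using assms(1)
  proof (induction gs)
    case (Cons g gs)
    have "0 \<le> code gs y \<and> code gs y < q"
    proof (cases "gs = []")
      case False
      then show ?thesis using Cons.IH q2_bounds(1) q_gt_half by linarith
    qed (use assms in simp)
    then have "0 \<le> (long ^^ g) (code gs y)" "(long ^^ g) (code gs y) < q"
      using long_pow_range by auto
    then show ?case
      unfolding code_Cons using short_range by blast
  qed simp
  then show "q^2 \<le> code gs y" "code gs y < 1 - q" by auto
qed

lemma code_range_below_q:
  assumes "0 \<le> y" "y < q"
  shows "0 \<le> code gs y" "code gs y < q"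
proof -
  have "0 \<le> code gs y \<and> code gs y < q"
  proof (cases "gs = []")
    case False
    then show ?thesis using code_range[OF False assms] q2_bounds(1) q_gt_half by linarith
  qed (use assms in simp)
  then show "0 \<le> code gs y" "code gs y < q" by auto
qed

lemma code_fixpoint_range:
  assumes "gs \<noteq> []" "code gs t = t"
  shows "q^2 \<le> t" "t < 1 - q"
proof -
  have ne: "spell gs \<noteq> []" using assms(1) by (simp add: spell_eq_Nil_iff)
  have "0 \<le> code gs 0"
    using code_range_below_q[of 0 gs] q_pos by simp
  then have "0 \<le> t" using le_fixpoint[OF ne assms(2)] by simp
  have "code gs (1 - q) \<le> 1 - q"
    using code_range[of gs "1 - q"] assms(1) q_less_1 q_gt_half by simp
  then have "t \<le> 1 - q" using fixpoint_le[OF ne assms(2)] by simp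
  then have "t < q" using q_gt_half by simp
  from code_range[OF assms(1) \<open>0 \<le> t\<close> this]
  show "q^2 \<le> t" "t < 1 - q" unfolding assms(2) .
qed

text \<open>Points are ordered like their gap lists, lexicographically: at the first difference the
  smaller gap meets the block \<open>01\<close> where the larger one still has \<open>011\<close>.\<close>

lemma first_gap_less:
  assumes "g < h" "0 \<le> u" "u < 1 - q" "0 \<le> v" "v < q"
  shows "code [g] u < code [h] v"
proof -
  have "u < (long ^^ (h - g)) v"
    using long_pow_range(3)[OF assms(4,5), of "h - g"] assms(1,3) by linarith
  then have "prepend ([0,1] @ word_power [0,1,1] g) u
      < prepend ([0,1] @ word_power [0,1,1] g) ((long ^^ (h - g)) v)"
    unfolding prepend_less_iff .
  then have "short ((long ^^ g) u) < short ((long ^^ g) ((long ^^ (h - g)) v))"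
    unfolding prepend_append prepend_word_power short_def .
  also have "(long ^^ g) ((long ^^ (h - g)) v) = (long ^^ h) v"
    using assms(1) by (simp add: funpow_funpow)
  finally show ?thesis unfolding code_Cons code_Nil .
qed

section \<open>Orbits of points given by gap lists\<close>

lemma orbit_short:
  assumes "0 \<le> y" "y < q"
  shows "q \<le> T (short y)" "T (T (short y)) = y"
proof -
  have *: "q * (1 + y) < 1"
  proof -
    have "q * (1 + y) < q * (1 + q)"
      using assms q_pos by (intro mult_strict_left_mono) auto
    also have "\<dots> = q + q^2"
      by (simp add: algebra_simps power2_eq_square)
    also have "\<dots> < 1"
      using q_sum zero_less_power[OF q_pos, of 3] by linarith
    finally show ?thesis .
  qed
  have "T (short y) = q * (1 + y)"
    using T_prepend_digit[of "q * (1 + y)" 0] * assms q_pos by (simp add: short_def)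
  moreover have "T (q * (1 + y)) = y"
    using T_prepend_digit[of y 1] assms q_less_1 by simp
  ultimately show "q \<le> T (short y)" "T (T (short y)) = y"
    using assms q_pos by simp_all
qed

lemma orbit_long:
  assumes "0 \<le> y" "y < q"
  shows "q \<le> T (long y)" "q \<le> T (T (long y))" "T (T (T (long y))) = y"
proof -
  let ?v = "q * (1 + y)" let ?u = "q * (1 + ?v)"
  have v: "?v = T (short y)" and "?v \<ge> 0"
  proof -
    show "?v \<ge> 0" using assms q_pos by simp
    have "T (short y) = T (q * (0 + ?v))" by (simp add: short_def)
    moreover have "?v < 1"
    proof -
      have "q * ?v = short y" by (simp add: short_def)
      then have "q * ?v < q * 1" using short_range(2)[OF assms] q_gt_half by simp
      then show ?thesis using q_pos by (simp only: mult_less_cancel_left_pos)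
    qed
    ultimately show "?v = T (short y)"
      using T_prepend_digit[of ?v 0] \<open>?v \<ge> 0\<close> by simp
  qed
  have v1: "?v < 1" unfolding v by (rule beta_map_range)
  have u1: "?u < 1"
  proof -
    have "q * ?u = long y" by (simp add: long_def)
    then have "q * ?u < q * 1" using long_range(2)[OF assms] by simp
    then show ?thesis using q_pos by (simp only: mult_less_cancel_left_pos)
  qed
  have u0: "0 \<le> ?u" using \<open>?v \<ge> 0\<close> q_pos by simp
  have 1: "T (long y) = ?u"
    using T_prepend_digit[of ?u 0] u0 u1 by (simp add: long_def)
  have 2: "T ?u = ?v"
    using T_prepend_digit[of ?v 1] \<open>?v \<ge> 0\<close> v1 by simp
  have 3: "T ?v = y"
    using T_prepend_digit[of y 1] assms q_less_1 by simp
  show "q \<le> T (long y)" unfolding 1 using \<open>?v \<ge> 0\<close> q_pos by simp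
  show "q \<le> T (T (long y))" unfolding 1 2 using assms q_pos by simp
  show "T (T (T (long y))) = y" unfolding 1 2 3 ..
qed

lemma funpow_T_add3: "(T ^^ (n + 3)) y = (T ^^ n) (T (T (T y)))"
  by (simp add: numeral_3_eq_3 funpow_swap1)

lemma funpow_T_add2: "(T ^^ (n + 2)) y = (T ^^ n) (T (T y))"
  by (simp add: numeral_2_eq_2 funpow_swap1)

lemma orbit_long_pow:
  assumes "0 \<le> y" "y < q"
  shows "(T ^^ (3 * g)) ((long ^^ g) y) = y"
    and "j < 3 * g \<Longrightarrow> 1 - q \<le> (T ^^ j) ((long ^^ g) y)"
proof -
  have "(T ^^ (3 * g)) ((long ^^ g) y) = y \<and> (\<forall>j<3 * g. 1 - q \<le> (T ^^ j) ((long ^^ g) y))"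
  proof (induction g)
    case (Suc g)
    define u where "u = (long ^^ g) y"
    have u: "0 \<le> u" "u < q" using long_pow_range[OF assms] by (auto simp: u_def)
    have "(T ^^ (3 * Suc g)) (long u) = y"
      using funpow_T_add3[of "3 * g" "long u"] Suc orbit_long(3)[OF u]
      by (simp add: u_def add.commute)
    moreover have "1 - q \<le> (T ^^ j) (long u)" if "j < 3 * Suc g" for j
    proof -
      have "j = 0 \<or> j = 1 \<or> j = 2 \<or> j = (j - 3) + 3 \<and> j - 3 < 3 * g"
        using that by (cases "j < 3") auto
      then consider "j = 0" | "j = 1" | "j = 2" | k where "j = k + 3" "k < 3 * g"
        by blast
      then show ?thesis
      proof cases
        case 4
        then show ?thesis
          using funpow_T_add3[of k "long u"] orbit_long(3)[OF u] Suc by (simp add: u_def)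
      qed (use long_range[OF u] orbit_long[OF u] q_gt_half in \<open>auto simp: numeral_2_eq_2\<close>)
    qed
    ultimately show ?case by (simp add: u_def)
  qed simp
  then show "(T ^^ (3 * g)) ((long ^^ g) y) = y"
    and "j < 3 * g \<Longrightarrow> 1 - q \<le> (T ^^ j) ((long ^^ g) y)" by auto
qed

lemma orbit_gap:
  assumes "0 \<le> y" "y < q"
  shows "(T ^^ (2 + 3 * g)) (code [g] y) = y"
    and "0 < j \<Longrightarrow> j < 2 + 3 * g \<Longrightarrow> 1 - q \<le> (T ^^ j) (code [g] y)"
proof -
  define u where "u = (long ^^ g) y"
  have u: "0 \<le> u" "u < q" using long_pow_range[OF assms] by (auto simp: u_def)
  have c: "code [g] y = short u" by (simp add: code_Cons u_def)
  show "(T ^^ (2 + 3 * g)) (code [g] y) = y"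
    using funpow_T_add2[of "3 * g" "short u"] orbit_short(2)[OF u] orbit_long_pow(1)[OF assms]
    by (simp add: c u_def add.commute)
  assume j: "0 < j" "j < 2 + 3 * g"
  show "1 - q \<le> (T ^^ j) (code [g] y)"
  proof (cases "j = 1")
    case True
    then show ?thesis using orbit_short(1)[OF u] q_gt_half by (simp add: c)
  next
    case False
    then have "j = (j - 2) + 2 \<and> j - 2 < 3 * g"
      using j by linarith
    then obtain k where "j = k + 2" "k < 3 * g"
      by blast
    then show ?thesis
      using funpow_T_add2[of k "short u"] orbit_short(2)[OF u] orbit_long_pow(2)[OF assms, of k g]
      by (simp add: c u_def)
  qed
qed

lemma orbit_code:
  assumes "0 \<le> y" "y < q"
  shows "(T ^^ length (spell gs)) (code gs y) = y"
proof (induction gs)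
  case (Cons g gs)
  have "length (spell (g # gs)) = length (spell gs) + (2 + 3 * g)"
    by (simp add: length_spell)
  moreover have "code (g # gs) y = code [g] (code gs y)" by (simp add: code_Cons)
  ultimately show ?case
    using orbit_gap(1)[where y = "code gs y" and g = g] code_range_below_q[OF assms, of gs] Cons
    by (simp only: funpow_add comp_def)
qed (simp add: spell_def)

text \<open>Only the points at the start of a block \<open>01\<close> compete for the minimum of an orbit, and these
  are the points whose gap lists are the proper suffixes.\<close>

lemma orbit_code_above:
  assumes t: "0 \<le> t" "t < q" and s: "s < 1 - q"
    and suffixes: "\<And>i. 0 < i \<Longrightarrow> i < length gs \<Longrightarrow> s < code (drop i gs) t"
    and j: "0 < j" "j < length (spell gs)"
  shows "s < (T ^^ j) (code gs t)"
  using suffixes j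
proof (induction gs arbitrary: j)
  case (Cons g gs)
  have c: "code (g # gs) t = code [g] (code gs t)" by (simp add: code_Cons)
  have r: "0 \<le> code gs t" "code gs t < q" using code_range_below_q[OF t] by auto
  show ?case
  proof (cases "j < 2 + 3 * g")
    case True
    then show ?thesis
      using orbit_gap(2)[OF r, of j g] Cons.prems(2) s c by simp
  next
    case False
    define k where "k = j - (2 + 3 * g)"
    have k: "j = k + (2 + 3 * g)"
      using False by (simp add: k_def)
    have kl: "k < length (spell gs)"
      using Cons.prems(3) k by (simp add: length_spell)
    have eq: "(T ^^ j) (code (g # gs) t) = (T ^^ k) (code gs t)"
      using orbit_gap(1)[OF r, of g] by (simp only: c k funpow_add[of k] comp_def)
    show ?thesis
    proof (cases "k = 0")
      case True
      then have "gs \<noteq> []" using kl by (auto simp: spell_def)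
      then show ?thesis using eq True Cons.prems(1)[of 1] by simp
    next
      case False
      moreover have "s < code (drop i gs) t" if "0 < i" "i < length gs" for i
        using Cons.prems(1)[of "Suc i"] that by simp
      ultimately show ?thesis
        using Cons.IH[of k] kl eq by simp
    qed
  qed
qed (simp add: spell_def)

section \<open>Reading a gap list off a surviving orbit\<close>

text \<open>Above \<open>q^2\<close> the digits \<open>00\<close> cannot occur, and \<open>111\<close> never occurs, so a digit \<open>0\<close> opens
  a block \<open>01\<close> or \<open>011\<close> that is again followed by \<open>0\<close>.\<close>

lemma surviving_block:
  assumes "y \<in> survivor_set \<beta> (q^2)" "y < q"
  shows "q \<le> T y"
    and "T (T y) < q \<and> y = short (T (T y))
       \<or> q \<le> T (T y) \<and> T (T (T y)) < q \<and> y = long (T (T (T y)))"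
proof -
  have y: "q^2 \<le> y" "0 \<le> y"
    using assms(1) by (auto simp: survivor_set_def dest: spec[of _ 0])
  have e1: "y = q * T y" using digit_0[OF y(2) assms(2)] .
  then have "q * q \<le> q * T y" using y(1) by (simp add: power2_eq_square)
  then show Ty: "q \<le> T y" using q_pos by (simp only: mult_le_cancel_left_pos)
  have e2: "T y = q * (1 + T (T y))"
    using digit_1[OF Ty] beta_map_range by blast
  show "T (T y) < q \<and> y = short (T (T y))
      \<or> q \<le> T (T y) \<and> T (T (T y)) < q \<and> y = long (T (T (T y)))"
  proof (cases "T (T y) < q")
    case True
    have "y = short (T (T y))"
      using e1 e2 by (simp add: short_def)
    with True show ?thesis by blast
  next
    case False
    then have e3: "T (T y) = q * (1 + T (T (T y)))"
      using digit_1[of "T (T y)"] beta_map_range by simp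
    have "y = long (T (T (T y)))"
      using e1 e2 e3 by (simp add: long_def)
    moreover have "T (T (T y)) < q"
    proof (rule ccontr)
      \<comment> \<open>Otherwise the digits of \<open>T y\<close> would start with \<open>111\<close>.\<close>
      assume "\<not> T (T (T y)) < q"
      then have "q^2 * q \<le> q^2 * T (T (T y))"
        using q_pos by (intro mult_left_mono) auto
      moreover have "T y = q * (1 + q * (1 + T (T (T y))))"
        using e2 e3 by simp
      then have "T y = q + q^2 + q^2 * T (T (T y))"
        by (simp add: algebra_simps power2_eq_square)
      ultimately have "1 \<le> T y"
        using q_sum by (simp add: power2_eq_square power3_eq_cube)
      then show False using beta_map_range(2)[of \<beta> y] by simp
    qed
    ultimately show ?thesis using False by simp
  qed
qed

text \<open>Cutting at the digits \<open>0\<close>: every visit to \<open>[0, q)\<close> starts a new block.\<close>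

lemma orbit_segment_blocks:
  assumes "y \<in> survivor_set \<beta> (q^2)" "y < q" "(T ^^ n) y < q"
  shows "\<exists>g gs. y = (long ^^ g) (code gs ((T ^^ n) y)) \<and> n = 3 * g + length (spell gs)"
  using assms
proof (induction n arbitrary: y rule: less_induct)
  case (less n)
  have surv: "(T ^^ k) y \<in> survivor_set \<beta> (q^2)" for k
    using survivor_set_funpow[OF less.prems(1)] .
  have surv2: "T (T y) \<in> survivor_set \<beta> (q^2)" and surv3: "T (T (T y)) \<in> survivor_set \<beta> (q^2)"
    using surv[of 2] surv[of 3] by (simp_all add: numeral_2_eq_2 numeral_3_eq_3)
  show ?case
  proof (cases "n = 0")
    case True
    then show ?thesis by (intro exI[of _ 0] exI[of _ "[]"]) (simp add: spell_def)
  next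
    case False
    have n1: "n \<noteq> 1" using surviving_block(1)[OF less.prems(1,2)] less.prems(3) by auto
    consider "T (T y) < q" "y = short (T (T y))"
      | "q \<le> T (T y)" "T (T (T y)) < q" "y = long (T (T (T y)))"
      using surviving_block(2)[OF less.prems(1,2)] by blast
    then show ?thesis
    proof cases
      case 1
      define k where "k = n - 2"
      have n: "n = k + 2" using False n1 by (simp add: k_def)
      have z: "(T ^^ n) y = (T ^^ k) (T (T y))" unfolding n by (rule funpow_T_add2)
      obtain g gs where g: "T (T y) = (long ^^ g) (code gs ((T ^^ k) (T (T y))))"
          "k = 3 * g + length (spell gs)"
        using less.IH[of k "T (T y)"] surv2 1 less.prems(3) n z by auto
      have "y = (long ^^ 0) (code (g # gs) ((T ^^ n) y))"
        unfolding z code_Cons using 1 g(1) by simp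
      moreover have "n = 3 * 0 + length (spell (g # gs))"
        using n g(2) by (simp add: length_spell)
      ultimately show ?thesis by blast
    next
      case 2
      define k where "k = n - 3"
      have "n \<noteq> 2" using 2(1) less.prems(3) by (auto simp: numeral_2_eq_2)
      then have n: "n = k + 3" using False n1 by (simp add: k_def)
      have z: "(T ^^ n) y = (T ^^ k) (T (T (T y)))" unfolding n by (rule funpow_T_add3)
      obtain g gs where g: "T (T (T y)) = (long ^^ g) (code gs ((T ^^ k) (T (T (T y)))))"
          "k = 3 * g + length (spell gs)"
        using less.IH[of k "T (T (T y))"] surv3 2 less.prems(3) n z by auto
      have "y = (long ^^ Suc g) (code gs ((T ^^ n) y))"
        unfolding z using 2(3) g(1) by simp
      moreover have "n = 3 * Suc g + length (spell gs)"
        using n g(2) by simp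
      ultimately show ?thesis by blast
    qed
  qed
qed

text \<open>An orbit made of blocks \<open>011\<close> only would contain the fixed point \<open>q\<close> of \<open>long\<close>.  But the
  first digit of \<open>q\<close> is \<open>1\<close>, not \<open>0\<close>: the word \<open>(011)^\<infinity>\<close> is a shift of the quasi-greedy expansion
  \<open>(110)^\<infinity>\<close> of \<open>1\<close>.\<close>

lemma short_block_occurs:
  assumes surv: "x \<in> survivor_set \<beta> (q^2)" and p: "0 < p" "(T ^^ p) x = x"
  shows "\<exists>n. (T ^^ n) x < q \<and> T (T ((T ^^ n) x)) < q"
proof (rule ccontr)
  assume no: "\<nexists>n. (T ^^ n) x < q \<and> T (T ((T ^^ n) x)) < q"
  have x: "0 \<le> x" "x < 1" using surv by (auto simp: survivor_set_def)
  have "\<exists>n. (T ^^ n) x < q"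
  proof (rule ccontr)
    assume "\<nexists>n. (T ^^ n) x < q"
    then have n: "q \<le> (T ^^ n) x" for n by (meson not_less)
    have "x = q * (1 + T x)" "T x = q * (1 + T (T x))"
      using digit_1[of x] digit_1[of "T x"] x n[of 0] n[of 1] beta_map_range by auto
    then have "x = q * (1 + q * (1 + T (T x)))" by simp
    then have "x = q + q^2 + q^2 * T (T x)" by (simp add: algebra_simps power2_eq_square)
    moreover have "q^2 * q \<le> q^2 * T (T x)"
      using n[of 2] q_pos by (intro mult_left_mono) (auto simp: numeral_2_eq_2)
    ultimately show False
      using q_sum x by (simp add: power2_eq_square power3_eq_cube)
  qed
  then obtain a where a: "(T ^^ a) x < q" by blast
  define y where "y = (T ^^ a) x"
  have "(T ^^ (3 * i)) y < q \<and> y = (long ^^ i) ((T ^^ (3 * i)) y)" for i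
  proof (induction i)
    case (Suc i)
    define w where "w = (T ^^ (3 * i)) y"
    have w: "w = (T ^^ (3 * i + a)) x" by (simp add: y_def w_def funpow_funpow)
    have IH: "w < q" "y = (long ^^ i) w" using Suc by (auto simp: w_def)
    have "q \<le> T (T w)" using no IH(1) w by (metis not_less)
    then have w3: "T (T (T w)) < q" "w = long (T (T (T w)))"
      using surviving_block(2)[of w] survivor_set_funpow[OF surv] IH(1) w by auto
    have "(T ^^ (3 * Suc i)) y = T (T (T w))"
      by (simp add: numeral_3_eq_3 w_def)
    moreover have "(long ^^ Suc i) (T (T (T w))) = (long ^^ i) w"
      by (simp only: funpow_Suc_right comp_def w3(2)[symmetric])
    ultimately show ?case using w3(1) IH(2) by simp
  qed (use a in \<open>simp add: y_def\<close>)
  then have "y = (long ^^ p) ((T ^^ (3 * p)) y)" by blast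
  moreover have "(T ^^ (3 * p)) y = y"
  proof -
    have "(T ^^ (3 * p)) y = (T ^^ (3 * p + a)) x" by (simp add: y_def funpow_funpow)
    also have "\<dots> = (T ^^ ((3 * p + a) mod p)) x" by (rule funpow_mod_eq[OF p(2), symmetric])
    also have "\<dots> = (T ^^ (a mod p)) x" by simp
    also have "\<dots> = y" unfolding y_def by (rule funpow_mod_eq[OF p(2)])
    finally show ?thesis .
  qed
  ultimately have "prepend (word_power [0,1,1] p) y = y"
    by (simp only: prepend_word_power)
  moreover have "prepend (word_power [0,1,1] p) q = q"
    unfolding prepend_word_power by (induction p) (simp_all add: long_q)
  moreover have "word_power [0,1,1::nat] p \<noteq> []"
    using p by (cases p) (simp_all add: word_power_Suc)
  ultimately have "y = q" using fixpoint_unique by blast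
  then show False using a by (simp add: y_def)
qed

text \<open>A fixed point of \<open>code gs\<close> is the point whose gaps repeat \<open>gs\<close> periodically.\<close>

definition realizes :: "real \<Rightarrow> nat list \<Rightarrow> bool" where
  "realizes x gs \<longleftrightarrow> gs \<noteq> [] \<and> (\<exists>n. code gs ((T ^^ n) x) = (T ^^ n) x)"

lemma gap_list_exists:
  assumes surv: "x \<in> survivor_set \<beta> (q^2)" and p: "0 < p" "(T ^^ p) x = x"
  shows "\<exists>gs. realizes x gs \<and> length (spell gs) = p"
proof -
  obtain n where n: "(T ^^ n) x < q" "T (T ((T ^^ n) x)) < q"
    using short_block_occurs[OF assms] by blast
  define y where "y = (T ^^ n) x"
  have y: "y \<in> survivor_set \<beta> (q^2)" "y < q"
    using survivor_set_funpow[OF surv] n by (auto simp: y_def)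
  have "(T ^^ p) y = y"
    using p(2) unfolding y_def by (metis funpow_funpow add.commute)
  then obtain g gs where g: "y = (long ^^ g) (code gs y)" "p = 3 * g + length (spell gs)"
    using orbit_segment_blocks[OF y, of p] y by auto
  have "g = 0"
  proof (rule ccontr)
    assume "g \<noteq> 0"
    have "0 \<le> y" using y by (simp add: survivor_set_def)
    then have "1 - q \<le> (long ^^ g) (code gs y)"
      using long_pow_range(3)[OF code_range_below_q[of y gs]] y(2) \<open>g \<noteq> 0\<close> by simp
    then have "1 - q \<le> y" using g(1) by linarith
    moreover have "y < 1 - q"
      using surviving_block(2)[OF y] n(2) short_range(2)[OF beta_map_range(1)]
      by (metis not_less y_def)
    ultimately show False by simp
  qed
  then have "code gs y = y" "length (spell gs) = p" using g by auto
  moreover from this have "gs \<noteq> []" using p by (auto simp: spell_def)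
  ultimately show ?thesis unfolding realizes_def y_def by blast
qed

lemma realizes_rotate:
  assumes "realizes x (us @ vs)"
  shows "realizes x (vs @ us)"
proof -
  obtain n where n: "us @ vs \<noteq> []" "code (us @ vs) ((T ^^ n) x) = (T ^^ n) x"
    using assms by (auto simp: realizes_def)
  define y where "y = (T ^^ n) x"
  have "0 \<le> y" "y < q"
    using code_fixpoint_range[OF n] q2_bounds(1) q_gt_half unfolding y_def by linarith+
  note r = code_range_below_q[OF this, of vs]
  have "(T ^^ length (spell us)) y = (T ^^ length (spell us)) (code us (code vs y))"
    using n(2) by (simp add: y_def code_append)
  also have "\<dots> = code vs y" by (rule orbit_code[OF r])
  finally have "code vs y = (T ^^ (length (spell us) + n)) x"
    by (simp add: y_def funpow_funpow)
  moreover have "code (vs @ us) (code vs y) = code vs y"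
    using n(2) by (simp add: y_def code_append)
  ultimately show ?thesis
    using n(1) unfolding realizes_def by (metis append_is_Nil_conv)
qed

lemma code_fixpoint_exists:
  assumes "gs \<noteq> []"
  shows "code gs (beta_value \<beta> (periodic_word (spell gs))) = beta_value \<beta> (periodic_word (spell gs))"
  using assms beta_value_periodic set_spell by (simp add: spell_eq_Nil_iff)

text \<open>A constant list of several gaps has the same fixed point as the list with one entry, hence a
  smaller period.\<close>

lemma realizes_not_constant:
  assumes "smallest_period \<beta> x (length (spell (replicate k g)))" "2 \<le> k"
  shows "\<not> realizes x (replicate k g)"
proof
  assume "realizes x (replicate k g)"
  then obtain n where n: "code (replicate k g) ((T ^^ n) x) = (T ^^ n) x"
    by (auto simp: realizes_def)
  define t where "t = beta_value \<beta> (periodic_word (spell [g]))"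
  have t: "code [g] t = t" unfolding t_def by (rule code_fixpoint_exists) simp
  have "code (replicate i g) t = t" for i
  proof (induction i)
    case (Suc i)
    then show ?case using t code_append[of "[g]" "replicate i g" t] by simp
  qed simp
  moreover have "spell (replicate k g) \<noteq> []" using assms(2) by (simp add: spell_eq_Nil_iff)
  ultimately have tn: "t = (T ^^ n) x" using n fixpoint_unique by blast
  have "0 \<le> t" "t < q"
    using code_fixpoint_range[of "[g]" t] t q2_bounds(1) q_gt_half by (simp; linarith)+
  then have "(T ^^ length (spell [g])) t = t"
    using orbit_code[of t "[g]"] t by simp
  moreover have "1 \<le> length (spell [g])" "length (spell [g]) < length (spell (replicate k g))"
    using assms(2) by (cases k; simp add: length_spell sum_list_replicate)+
  ultimately show False
    using smallest_period_funpow[OF assms(1), of n] unfolding tn smallest_period_def by blast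
qed

section \<open>Comparing gap lists\<close>

lemma code_range_below_1_minus_q:
  assumes "0 \<le> y" "y < 1 - q"
  shows "0 \<le> code gs y" "code gs y < 1 - q"
proof -
  have "y < q" using assms q_gt_half by simp
  then show "0 \<le> code gs y" using code_range_below_q(1) assms(1) by blast
  show "code gs y < 1 - q"
    using code_range(2)[OF _ assms(1) \<open>y < q\<close>, of gs] assms by (cases "gs = []") auto
qed

lemma lex_less:
  assumes "g < h" "0 \<le> u" "u < 1 - q" "0 \<le> v" "v < 1 - q"
  shows "code (us @ g # gs) u < code (us @ h # hs) v"
proof -
  have "code hs v < q" using code_range_below_1_minus_q(2)[OF assms(4,5), of hs] q_gt_half by simp
  then have "code [g] (code gs u) < code [h] (code hs v)"
    using first_gap_less assms code_range_below_1_minus_q by blast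
  moreover have "code (us @ k # ks) y = code us (code [k] (code ks y))" for k ks y
    by (simp add: code_append code_Cons)
  ultimately show ?thesis by (simp add: prepend_less_iff)
qed

text \<open>If every point of an orbit lies above the fixed point of \<open>hs\<close>, then no gap list realized by
  the orbit is lexicographically smaller than \<open>hs\<close>.\<close>

lemma realizes_lex:
  assumes "realizes x (us @ g # gs)" "code (us @ h # hs) t = t" "\<And>n. t < (T ^^ n) x"
  shows "h \<le> g"
proof (rule ccontr)
  assume "\<not> h \<le> g"
  obtain n where n: "code (us @ g # gs) ((T ^^ n) x) = (T ^^ n) x"
    using assms(1) by (auto simp: realizes_def)
  have "0 \<le> (T ^^ n) x" "(T ^^ n) x < 1 - q" "0 \<le> t" "t < 1 - q"
    using code_fixpoint_range[OF _ n] code_fixpoint_range[OF _ assms(2)] q2_bounds(1)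
    by (simp_all, linarith+)
  then have "(T ^^ n) x < t"
    using lex_less[of g h "(T ^^ n) x" t us gs hs] \<open>\<not> h \<le> g\<close> n assms(2) by simp
  then show False using assms(3)[of n] by simp
qed

text \<open>Every gap of the orbit is the first entry of some rotation.\<close>

lemma realizes_gap_ge:
  assumes "realizes x gs" "code (h # hs) t = t" "\<And>n. t < (T ^^ n) x"
  shows "\<forall>g\<in>set gs. h \<le> g"
proof
  fix g assume "g \<in> set gs"
  then obtain us vs where "gs = us @ g # vs" by (meson split_list)
  then have "realizes x (g # vs @ us)"
    using realizes_rotate[of x us "g # vs"] assms(1) by simp
  then show "h \<le> g"
    using realizes_lex[of x "[]" g "vs @ us" h hs t] assms by simp
qed

lemma not_realizes_self:
  assumes "code hs t = t" "\<And>n. t < (T ^^ n) x"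
  shows "\<not> realizes x hs"
proof
  assume "realizes x hs"
  then obtain n where n: "hs \<noteq> []" "code hs ((T ^^ n) x) = (T ^^ n) x"
    by (auto simp: realizes_def)
  then have "(T ^^ n) x = t"
    using fixpoint_unique[of "spell hs" t] assms(1) by (simp add: spell_eq_Nil_iff)
  then show False using assms(2)[of n] by simp
qed

section \<open>The maximal orbits of each period\<close>

text \<open>Lexicographic comparison; a proper prefix is not comparable, because the order of the periodic
  continuations is then still open.\<close>

fun lex_below :: "nat list \<Rightarrow> nat list \<Rightarrow> bool" where
  "lex_below [] [] \<longleftrightarrow> True"
| "lex_below (g # gs) (h # hs) \<longleftrightarrow> g < h \<or> g = h \<and> lex_below gs hs"
| "lex_below _ _ \<longleftrightarrow> False"

lemma lex_below_cases:
  assumes "lex_below gs hs"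
  shows "gs = hs \<or> (\<exists>ks g gs' h hs'. gs = ks @ g # gs' \<and> hs = ks @ h # hs' \<and> g < h)"
  using assms
proof (induction gs hs rule: lex_below.induct)
  case (2 g gs h hs)
  show ?case
  proof (cases "g < h")
    case True
    then show ?thesis by (intro disjI2 exI[of _ "[]"]) auto
  next
    case False
    then have "g = h" "lex_below gs hs" using "2.prems" by auto
    then show ?thesis using "2.IH" False by (metis append_Cons)
  qed
qed simp_all

definition rotation_below :: "nat list \<Rightarrow> nat list \<Rightarrow> bool" where
  "rotation_below gs hs \<longleftrightarrow> (\<exists>us vs. gs = us @ vs \<and> lex_below (vs @ us) hs)"

lemma not_realizes_rotation_below:
  assumes "rotation_below gs hs" "code hs t = t" "\<And>n. t < (T ^^ n) x"
  shows "\<not> realizes x gs"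
proof
  assume "realizes x gs"
  then obtain gs' where "realizes x gs'" "lex_below gs' hs"
    using assms(1) realizes_rotate unfolding rotation_below_def by blast
  then show False
    using lex_below_cases[of gs' hs] not_realizes_self[OF assms(2,3)]
      realizes_lex[OF _ _ assms(3)] assms(2) by (metis not_less)
qed

text \<open>The maximum over all orbits of a period is thus a matter of counting: a gap list whose fixed
  point is its own strict minimum is optimal as soon as every competitor of the same total length
  has a rotation that is not larger.  A competitor with two or more gaps may be assumed to be
  non-constant, since otherwise its period is smaller.  It may also be assumed to have no gap below
  the first gap of the candidate, since otherwise the rotation to that gap is smaller.\<close>

lemma S_code:
  assumes hs: "hs \<noteq> []"
    and suffixes: "\<And>t i. code hs t = t \<Longrightarrow> 0 \<le> t \<Longrightarrow> t < 1 - q \<Longrightarrow> 0 < i \<Longrightarrow> i < length hs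
      \<Longrightarrow> t < code (drop i hs) t"
    and competitors: "\<And>gs. gs \<noteq> [] \<Longrightarrow> length (spell gs) = length (spell hs)
      \<Longrightarrow> (\<And>g. 2 \<le> length gs \<Longrightarrow> set gs \<noteq> {g}) \<Longrightarrow> \<forall>g\<in>set gs. hd hs \<le> g
      \<Longrightarrow> rotation_below gs hs"
  shows "S \<beta> (length (spell hs)) = beta_value \<beta> (periodic_word (spell hs))"
proof -
  define t where "t = beta_value \<beta> (periodic_word (spell hs))"
  define p where "p = length (spell hs)"
  have t: "code hs t = t" unfolding t_def using code_fixpoint_exists[OF hs] .
  have r: "q^2 \<le> t" "t < 1 - q" using code_fixpoint_range[OF hs t] .
  then have r': "0 \<le> t" "t < q" "t < 1" using q2_bounds(1) q_gt_half q_pos by linarith+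
  have p: "0 < p" using hs by (simp add: p_def spell_eq_Nil_iff)
  have "S \<beta> p = t"
  proof (rule S_eqI)
    show "(T ^^ p) t = t" using orbit_code[OF r'(1,2), of hs] t by (simp add: p_def)
    show "t < (T ^^ j) t" if "0 < j" "j < p" for j
      using orbit_code_above[OF r'(1,2) r(2), of hs j] suffixes[OF t r'(1) r(2)] that t
      by (simp add: p_def)
    show "\<exists>n. (T ^^ n) x \<le> t" if x: "0 \<le> x" "x < 1" "smallest_period \<beta> x p" for x
    proof (rule ccontr)
      assume "\<nexists>n. (T ^^ n) x \<le> t"
      then have above: "t < (T ^^ n) x" for n by (meson not_le)
      then have "q^2 \<le> (T ^^ n) x" for n using r(1) by (meson less_imp_le order_trans)
      then have "x \<in> survivor_set \<beta> (q^2)"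
        using x by (simp add: survivor_set_def)
      moreover have "(T ^^ p) x = x" using x by (simp add: smallest_period_def)
      ultimately obtain gs where gs: "realizes x gs" "length (spell gs) = p"
        using gap_list_exists[OF _ p] by blast
      have "set gs \<noteq> {g}" if "2 \<le> length gs" for g
      proof
        assume "set gs = {g}"
        then have "gs = replicate (length gs) g" by (metis replicate_eqI singletonD)
        then show False using realizes_not_constant[of x "length gs" g] x(3) gs that by simp
      qed
      moreover have "\<forall>g\<in>set gs. hd hs \<le> g"
        using realizes_gap_ge[OF gs(1), of "hd hs" "tl hs" t] t above hs by simp
      moreover have "gs \<noteq> []" using gs(1) by (simp add: realizes_def)
      ultimately have "rotation_below gs hs"
        using competitors[of gs] gs(2) by (simp add: p_def)
      then show False using not_realizes_rotation_below[OF _ t above] gs(1) by blast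
    qed
  qed (use p r' in auto)
  then show ?thesis by (simp add: p_def t_def)
qed

text \<open>The number of gaps of a word of given length is determined modulo \<open>3\<close>; three more short blocks
  cost two long ones, and then there are too few long blocks to fill all gaps up to \<open>h\<close>, except
  when \<open>h = 0\<close>.\<close>

lemma gap_count:
  assumes len: "length (spell gs) = length (spell hs)" and ge: "\<forall>g\<in>set gs. h \<le> g"
    and "gs \<noteq> []" "length hs \<le> 3" "hs \<noteq> []" and few: "sum_list hs \<le> length hs * h + 3"
  shows "length gs = length hs \<and> sum_list gs = sum_list hs
    \<or> h = 0 \<and> length gs = length hs + 3 \<and> sum_list gs + 2 = sum_list hs"
proof -
  have eq: "2 * length gs + 3 * sum_list gs = 2 * length hs + 3 * sum_list hs"
    using len by (simp add: length_spell)
  have "0 < length gs" "0 < length hs" using assms by auto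
  then have "\<exists>j. length gs = length hs + 3 * j"
    using eq assms(4) by presburger
  then obtain j where j: "length gs = length hs + 3 * j" ..
  have s: "sum_list gs + 2 * j = sum_list hs" using eq j by simp
  have "(length hs + 3 * j) * h \<le> sum_list gs"
    using sum_list_ge_length_mult[OF ge] j by simp
  then have *: "3 * (j * h) + 2 * j \<le> 3"
    using s few by (simp add: algebra_simps)
  then have "j = 0 \<or> j = 1 \<and> h = 0" by (cases j; cases h) auto
  then show ?thesis using j s by auto
qed

lemma rotation_belowI: "lex_below (vs @ us) hs \<Longrightarrow> rotation_below (us @ vs) hs"
  unfolding rotation_below_def by blast

lemma rotation_belowI2:
  "lex_below [a,b] hs \<or> lex_below [b,a] hs \<Longrightarrow> rotation_below [a,b] hs"
  using rotation_belowI[of "[a,b]" "[]" hs] rotation_belowI[of "[b]" "[a]" hs] by auto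

lemma rotation_belowI3:
  "lex_below [a,b,c] hs \<or> lex_below [b,c,a] hs \<or> lex_below [c,a,b] hs
    \<Longrightarrow> rotation_below [a,b,c] hs"
  using rotation_belowI[of "[a,b,c]" "[]" hs] rotation_belowI[of "[b,c]" "[a]" hs]
    rotation_belowI[of "[c]" "[a,b]" hs] by auto

lemma less_code_suffix:
  assumes "code (us @ g # gs) t = t" "0 \<le> t" "t < 1 - q" "g < h"
  shows "t < code (us @ h # hs) t"
  using lex_less[of g h t t us gs hs] assms by simp

lemma list_length_1: "length xs = 1 \<Longrightarrow> \<exists>a. xs = [a]"
  by (auto simp: length_Suc_conv)

lemma list_length_2: "length xs = 2 \<Longrightarrow> \<exists>a b. xs = [a,b]"
  by (auto simp: length_Suc_conv numeral_2_eq_2)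

lemma list_length_3: "length xs = 3 \<Longrightarrow> \<exists>a b c. xs = [a,b,c]"
  by (auto simp: length_Suc_conv numeral_3_eq_3)

lemma constant_if_sum_list_eq_0:
  fixes gs :: "nat list"
  assumes "gs \<noteq> []" "sum_list gs = 0"
  shows "set gs = {0}"
  using assms by (cases gs) auto

lemma S_one_gap: "S \<beta> (length (spell [m])) = beta_value \<beta> (periodic_word (spell [m]))"
proof (rule S_code)
  fix gs assume gs: "gs \<noteq> []" "length (spell gs) = length (spell [m])" "\<forall>g\<in>set gs. hd [m] \<le> g"
  then have "length gs = 1" "sum_list gs = m"
    using gap_count[of gs "[m]" m] by auto
  then have "gs = [m]" using list_length_1[of gs] by auto
  then show "rotation_below gs [m]"
    using rotation_belowI[of "[m]" "[]" "[m]"] by simp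
qed auto

lemma S_two_gaps:
  assumes "b = h + 1 \<or> b = h + 2"
  shows "S \<beta> (length (spell [h,b])) = beta_value \<beta> (periodic_word (spell [h,b]))"
proof (rule S_code)
  fix t i assume t: "code [h,b] t = t" "0 \<le> t" "t < 1 - q" and i: "0 < i" "i < length [h,b]"
  have "i = 1" using i by auto
  moreover have "t < code ([] @ b # []) t"
    using assms t by (intro less_code_suffix[of "[]" h "[b]"]) auto
  ultimately show "t < code (drop i [h,b]) t" by simp
next
  fix gs
  assume gs: "gs \<noteq> []" "length (spell gs) = length (spell [h,b])" "\<forall>g\<in>set gs. hd [h,b] \<le> g"
    and nc: "\<And>g. 2 \<le> length gs \<Longrightarrow> set gs \<noteq> {g}"
  have "length gs = 2 \<and> sum_list gs = h + b
      \<or> h = 0 \<and> length gs = 5 \<and> sum_list gs + 2 = h + b"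
    using gap_count[OF gs(2), of h] gs assms by auto
  then show "rotation_below gs [h,b]"
  proof
    assume *: "length gs = 2 \<and> sum_list gs = h + b"
    then obtain x y where xy: "gs = [x,y]" using list_length_2 by blast
    have "x \<noteq> y" using nc[of x] xy by auto
    moreover have "h \<le> x" "h \<le> y" "x + y = h + b" using gs(3) xy * by auto
    ultimately show ?thesis
      unfolding xy using assms by (intro rotation_belowI2) auto
  next
    assume *: "h = 0 \<and> length gs = 5 \<and> sum_list gs + 2 = h + b"
    then have "sum_list gs = 0" using assms by auto
    then have "set gs = {0}" by (rule constant_if_sum_list_eq_0[OF gs(1)])
    then show ?thesis using nc[of 0] * by simp
  qed
qed simp

lemma S_three_gaps:
  assumes "(b, c) \<in> {(h, h + 1), (h + 1, h + 1), (h + 2, h + 1)}"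
  shows "S \<beta> (length (spell [h,b,c])) = beta_value \<beta> (periodic_word (spell [h,b,c]))"
proof (rule S_code)
  fix t i assume t: "code [h,b,c] t = t" "0 \<le> t" "t < 1 - q" and i: "0 < i" "i < length [h,b,c]"
  have c: "h < c" using assms by auto
  have "i = 1 \<or> i = 2" using i by auto
  then show "t < code (drop i [h,b,c]) t"
  proof
    assume "i = 1"
    moreover have "t < code [b,c] t"
    proof (cases "h < b")
      case True
      then have "t < code ([] @ b # [c]) t"
        using t by (intro less_code_suffix[of "[]" h "[b,c]"]) auto
      then show ?thesis by simp
    next
      case False
      then have "b = h" using assms by auto
      then have "t < code ([h] @ c # []) t"
        using t c by (intro less_code_suffix[of "[h]" h "[c]"]) auto
      then show ?thesis using \<open>b = h\<close> by simp
    qed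
    ultimately show ?thesis by simp
  next
    assume "i = 2"
    moreover have "t < code ([] @ c # []) t"
      using t c by (intro less_code_suffix[of "[]" h "[b,c]"]) auto
    ultimately show ?thesis by simp
  qed
next
  fix gs
  assume gs: "gs \<noteq> []" "length (spell gs) = length (spell [h,b,c])" "\<forall>g\<in>set gs. hd [h,b,c] \<le> g"
    and nc: "\<And>g. 2 \<le> length gs \<Longrightarrow> set gs \<noteq> {g}"
  have "length gs = 3 \<and> sum_list gs = h + b + c
      \<or> h = 0 \<and> length gs = 6 \<and> sum_list gs + 2 = h + b + c"
    using gap_count[OF gs(2), of h] gs assms by auto
  then show "rotation_below gs [h,b,c]"
  proof
    assume *: "length gs = 3 \<and> sum_list gs = h + b + c"
    then obtain x y z where xyz: "gs = [x,y,z]" using list_length_3 by blast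
    define x' y' z' where "x' = x - h" "y' = y - h" "z' = z - h"
    then have e: "x = h + x'" "y = h + y'" "z = h + z'" using gs(3) xyz by auto
    have "\<not> (x' = y' \<and> y' = z')" using nc[of x] xyz e by auto
    moreover have "x' + y' + z' + 3 * h = h + b + c" using * xyz e by simp
    ultimately show ?thesis
      unfolding xyz e using assms by (intro rotation_belowI3) auto
  next
    assume *: "h = 0 \<and> length gs = 6 \<and> sum_list gs + 2 = h + b + c"
    then have "set gs \<noteq> {0}" using nc[of 0] by simp
    then have "sum_list gs \<noteq> 0"
      using constant_if_sum_list_eq_0[OF gs(1)] by blast
    then have sum: "sum_list gs = 1" and bc: "h = 0" "b = 2" "c = 1" using * assms by auto
    \<comment> \<open>Six gaps and a single block \<open>011\<close>: two adjacent gaps are empty.\<close>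
    obtain v w x y z u where g6: "gs = [v,w,x,y,z,u]"
      using * by (auto simp: length_Suc_conv eval_nat_numeral)
    then have "v = 0 \<and> w = 0 \<or> x = 0 \<and> y = 0" using sum by auto
    then show ?thesis
      unfolding g6 bc
      using rotation_belowI[of "[v,w,x,y,z,u]" "[]" "[0,2,1]"]
        rotation_belowI[of "[x,y,z,u]" "[v,w]" "[0,2,1]"] by auto
  qed
qed simp

section \<open>The exceptional periods\<close>

text \<open>For the periods \<open>3\<close>, \<open>4\<close>, \<open>6\<close> every admissible word without \<open>00\<close> has a smaller period, so the
  optimum has exactly one \<open>00\<close>: it is a digit \<open>0\<close> followed by blocks, and its first point is the
  only one below \<open>q^2\<close>.\<close>

lemma constant_gaps_small:
  assumes "length (spell gs) \<in> {3,4,6}" "gs \<noteq> []"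
  shows "gs = replicate (length gs) 0 \<and> 2 \<le> length gs"
proof -
  have "2 * length gs + 3 * sum_list gs = 3 \<or> 2 * length gs + 3 * sum_list gs = 4
      \<or> 2 * length gs + 3 * sum_list gs = 6"
    using assms(1) by (auto simp: length_spell)
  moreover have "0 < length gs" using assms(2) by simp
  ultimately have "sum_list gs = 0 \<and> 2 \<le> length gs" by presburger
  then show ?thesis
    using constant_if_sum_list_eq_0[OF assms(2)] by (metis replicate_eqI singletonD)
qed

text \<open>Here \<open>f\<close> prepends the blocks that follow the leading \<open>0\<close> of \<open>w\<close>.  An orbit that survives
  \<open>q^2\<close> would have only empty gaps and hence period \<open>2\<close>.  Any other orbit visits \<open>[0, q^2)\<close>, and
  there a single comparison with the map \<open>prepend w\<close> decides, since a point below its image lies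
  below the fixed point.\<close>

lemma S_exceptional:
  fixes f :: "real \<Rightarrow> real"
  assumes len: "length w = p" and p: "p \<in> {3,4,6}" and w: "set w \<subseteq> {0,1}"
    and f: "\<And>y. prepend w y = q * f y"
    and range: "\<And>y. 0 \<le> y \<Longrightarrow> y < q \<Longrightarrow> q^2 \<le> f y \<and> f y < q"
    and orbit: "\<And>y j. 0 \<le> y \<Longrightarrow> y < q \<Longrightarrow> Suc j < p \<Longrightarrow> q^2 \<le> (T ^^ j) (f y)"
    and return: "\<And>y. 0 \<le> y \<Longrightarrow> y < q \<Longrightarrow> (T ^^ (p - 1)) (f y) = y"
    and maximal: "\<And>y. 0 \<le> y \<Longrightarrow> y < q^2 \<Longrightarrow> (T ^^ p) y = y \<Longrightarrow> y \<le> prepend w y"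
  shows "S \<beta> (p) = beta_value \<beta> (periodic_word w)"
proof -
  define t where "t = beta_value \<beta> (periodic_word w)"
  have ne: "w \<noteq> []" using len p by auto
  have t: "prepend w t = t" unfolding t_def by (rule beta_value_periodic[OF ne w])
  have t0: "0 \<le> t"
  proof (rule le_fixpoint[OF ne t])
    have "0 \<le> f 0" using range[of 0] q_pos q2_bounds(1) by linarith
    then show "0 \<le> prepend w 0" using q_pos by (simp add: f)
  qed
  have q20: "0 \<le> q^2" using q2_bounds(1) by linarith
  have qf: "q * f y < q^2" if "0 \<le> y" "y < q" for y
    using range[OF that] q_pos by (simp add: power2_eq_square)
  have "t \<le> q^2"
    using qf[OF q20 q2_less_q] by (intro fixpoint_le[OF ne t]) (simp add: f)
  then have tq: "t < q" using q2_less_q by simp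
  have t2: "t < q^2" using qf[OF t0 tq] t by (simp add: f)
  have "T (q * (real 0 + f t)) = f t"
    using range[OF t0 tq] q20 q_less_1 by (intro T_prepend_digit) linarith+
  then have Tt: "T t = f t" using t by (simp add: f)
  show ?thesis
    unfolding t_def[symmetric]
  proof (rule S_eqI)
    show "0 < p" using p by auto
    show "0 \<le> t" by (rule t0)
    show "t < 1" using tq q_less_1 by simp
    have shift: "(T ^^ Suc j) t = (T ^^ j) (f t)" for j
      by (simp add: funpow_swap1 Tt)
    show "(T ^^ p) t = t"
    proof -
      have "Suc (p - 1) = p" using p by auto
      then show ?thesis using return[OF t0 tq] shift[of "p - 1"] by (simp only:)
    qed
    show "t < (T ^^ j) t" if j: "0 < j" "j < p" for j
      using orbit[OF t0 tq, of "j - 1"] shift[of "j - 1"] j t2 by simp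
    fix x assume x: "0 \<le> x" "x < 1" "smallest_period \<beta> x (p)"
    show "\<exists>n. (T ^^ n) x \<le> t"
    proof (cases "x \<in> survivor_set \<beta> (q^2)")
      case True
      have "0 < p" "(T ^^ p) x = x" using x(3) by (auto simp: smallest_period_def)
      then obtain gs where gs: "realizes x gs" "length (spell gs) = p"
        using gap_list_exists[OF True] by blast
      moreover have "gs \<noteq> []" using gs(1) by (simp add: realizes_def)
      ultimately have "gs = replicate (length gs) 0" "2 \<le> length gs"
        using constant_gaps_small[of gs] p by auto
      then show ?thesis
        using realizes_not_constant[of x "length gs" 0] x(3) gs by simp
    next
      case False
      then obtain n where n: "(T ^^ n) x < q^2"
        using x by (auto simp: survivor_set_def not_le)
      have "smallest_period \<beta> ((T ^^ n) x) (p)"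
        by (rule smallest_period_funpow[OF x(3)])
      then have "(T ^^ p) ((T ^^ n) x) = (T ^^ n) x" by (simp add: smallest_period_def)
      then have "(T ^^ n) x \<le> prepend w ((T ^^ n) x)"
        using maximal[of "(T ^^ n) x"] n funpow_beta_map_range(1)[OF x(1,2)] by blast
      then show ?thesis using le_fixpoint[OF ne t] by blast
    qed
  qed
qed

lemma double_zero:
  assumes "0 \<le> y" "y < q^2"
  shows "y = q * (q * T (T y))"
proof -
  have "y < q" using assms q2_less_q by linarith
  then have e: "y = q * T y" using digit_0 assms(1) by blast
  then have "q * T y < q * q" using assms(2) by (simp add: power2_eq_square)
  then have "T y < q" using q_pos by simp
  then have "T y = q * T (T y)" using digit_0 beta_map_range by blast
  then show ?thesis using e by simp
qed

lemma short_range': "0 \<le> y \<Longrightarrow> y < q \<Longrightarrow> 0 \<le> short y \<and> short y < q"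
  using short_range[of y] q2_bounds(1) q_gt_half by linarith

lemma long_range': "0 \<le> y \<Longrightarrow> y < q \<Longrightarrow> q^2 \<le> long y \<and> long y < q"
  using long_range[of y] q2_bounds(2) by linarith

lemma q_mult_mono: "y \<le> z \<Longrightarrow> q * y \<le> q * z"
  using q_pos by simp

lemma S_3: "S \<beta> 3 = beta_value \<beta> (periodic_word [0,0,1])"
proof (rule S_exceptional[where f = short])
  show "prepend [0,0,1] y = q * short y" for y by (simp add: short_def)
next
  fix y assume y: "0 \<le> y" "y < q"
  show "q^2 \<le> short y \<and> short y < q" using short_range[OF y] short_range'[OF y] by blast
  show "(T ^^ (3 - 1)) (short y) = y"
    using orbit_short[OF y] by (simp add: numeral_2_eq_2)
  show "q^2 \<le> (T ^^ j) (short y)" if "Suc j < 3" for j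
  proof -
    have "j = 0 \<or> j = 1" using that by auto
    then show ?thesis
      using short_range(1)[OF y] orbit_short(1)[OF y] q2_less_q by auto
  qed
next
  fix y assume y: "0 \<le> y" "y < q^2" and per: "(T ^^ 3) y = y"
  have "T (T y) \<le> q * (1 + T (T (T y)))"
    using le_prepend_1 beta_map_range by blast
  also have "T (T (T y)) = y" using per by (simp add: numeral_3_eq_3)
  finally have "q * (q * T (T y)) \<le> q * (q * (q * (1 + y)))"
    by (intro q_mult_mono)
  then show "y \<le> prepend [0,0,1] y" using double_zero[OF y] by simp
qed auto

lemma S_4: "S \<beta> 4 = beta_value \<beta> (periodic_word [0,0,1,1])"
proof (rule S_exceptional[where f = long])
  show "prepend [0,0,1,1] y = q * long y" for y by (simp add: long_def)
next
  fix y assume y: "0 \<le> y" "y < q"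
  show "q^2 \<le> long y \<and> long y < q" using long_range'[OF y] .
  show "(T ^^ (4 - 1)) (long y) = y"
    using orbit_long[OF y] by (simp add: numeral_3_eq_3)
  show "q^2 \<le> (T ^^ j) (long y)" if "Suc j < 4" for j
  proof -
    have "j = 0 \<or> j = 1 \<or> j = 2" using that by auto
    then show ?thesis
      using long_range'[OF y] orbit_long(1,2)[OF y] q2_less_q by (auto simp: numeral_2_eq_2)
  qed
next
  fix y assume y: "0 \<le> y" "y < q^2" and per: "(T ^^ 4) y = y"
  have "T (T y) \<le> q * (1 + T (T (T y)))"
    using le_prepend_1 beta_map_range by blast
  also have "\<dots> \<le> q * (1 + q * (1 + T (T (T (T y)))))"
    using le_prepend_1[of "T (T (T y))"] beta_map_range by (intro q_mult_mono add_left_mono) blast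
  also have "T (T (T (T y))) = y" using per by (simp add: eval_nat_numeral)
  finally have "q * (q * T (T y)) \<le> q * (q * (q * (1 + q * (1 + y))))"
    by (intro q_mult_mono)
  then show "y \<le> prepend [0,0,1,1] y" using double_zero[OF y] by simp
qed auto

lemma S_6: "S \<beta> 6 = beta_value \<beta> (periodic_word [0,0,1,1,0,1])"
proof (rule S_exceptional[where f = "\<lambda>y. long (short y)"])
  show "prepend [0,0,1,1,0,1] y = q * long (short y)" for y by (simp add: long_def short_def)
next
  fix y assume y: "0 \<le> y" "y < q"
  define u where "u = short y"
  have u: "0 \<le> u" "u < q" using short_range'[OF y] by (simp_all add: u_def)
  show "q^2 \<le> long (short y) \<and> long (short y) < q" using long_range'[OF u] by (simp add: u_def)
  have iter: "(T ^^ 1) (long u) = T (long u)" "(T ^^ 2) (long u) = T (T (long u))"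
    "(T ^^ 3) (long u) = u" "(T ^^ 4) (long u) = T u" "(T ^^ 5) (long u) = y"
    using orbit_long(3)[OF u] orbit_short(2)[OF y] by (simp_all add: eval_nat_numeral u_def)
  have "(6::nat) - 1 = 5" by simp
  then show "(T ^^ (6 - 1)) (long (short y)) = y"
    using iter(5) by (simp only: u_def)
  show "q^2 \<le> (T ^^ j) (long (short y))" if "Suc j < 6" for j
  proof -
    have "q^2 \<le> u" "q \<le> T u"
      using short_range(1)[OF y] orbit_short(1)[OF y] by (simp_all add: u_def)
    then have "q^2 \<le> (T ^^ j) (long u)" if "j \<in> {0, 1, 2, 3, 4}" for j
      using that long_range'[OF u] orbit_long(1,2)[OF u] q2_less_q iter by auto
    moreover have "j \<in> {0, 1, 2, 3, 4}" using that by auto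
    ultimately show ?thesis by (simp add: u_def)
  qed
next
  fix y assume y: "0 \<le> y" "y < q^2" and per: "(T ^^ 6) y = y"
  define v where "v = T (T y)"
  have y6: "T (T (T (T v))) = y" using per by (simp add: eval_nat_numeral v_def)
  have v: "0 \<le> v" "v < 1" using beta_map_range by (simp_all add: v_def)
  let ?r = "q * (1 + q * (1 + q * (q * (1 + y))))"
  have pos: "0 \<le> q * (q * (1 + y))" using q_pos y(1) by simp
  have "v \<le> ?r"
  proof -
    consider "v < q" | "q \<le> v" "T v < q" | "q \<le> v" "q \<le> T v" by linarith
    then show ?thesis
    proof cases
      case 1
      have "q * 1 \<le> ?r" using pos q_pos by (intro q_mult_mono) simp
      then show ?thesis using 1 by simp
    next
      case 2
      have "v = q * (1 + T v)" using digit_1[of v] 2 v by simp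
      also have "\<dots> \<le> q * (1 + q * 1)" using 2 by (intro q_mult_mono) simp
      also have "\<dots> \<le> ?r" using pos by (intro q_mult_mono add_left_mono) simp
      finally show ?thesis .
    next
      case 3
      have e1: "v = q * (1 + T v)" using digit_1[of v] 3 v by simp
      have e2: "T v = q * (1 + T (T v))" using digit_1[of "T v"] 3 beta_map_range by blast
      have "T (T v) < q"
      proof (rule ccontr)
        assume "\<not> T (T v) < q"
        then have "q * (1 + q * (1 + q)) \<le> q * (1 + q * (1 + T (T v)))"
          by (intro q_mult_mono add_left_mono) simp
        also have "\<dots> = v" using e1 e2 by simp
        finally show False
          using v(2) q_sum by (simp add: algebra_simps power2_eq_square power3_eq_cube)
      qed
      then have "T (T v) = q * T (T (T v))" using digit_0 beta_map_range by blast
      also have "T (T (T v)) \<le> q * (1 + T (T (T (T v))))"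
        using le_prepend_1 beta_map_range by blast
      finally have "T (T v) \<le> q * (q * (1 + y))"
        using q_mult_mono unfolding y6 by simp
      then have "q * (1 + q * (1 + T (T v))) \<le> ?r"
        by (intro q_mult_mono add_left_mono)
      then show ?thesis using e1 e2 by simp
    qed
  qed
  then have "q * (q * v) \<le> q * (q * ?r)" by (intro q_mult_mono)
  then show "y \<le> prepend [0,0,1,1,0,1] y"
    using double_zero[OF y] by (simp add: v_def)
qed auto

lemma S_1: "S \<beta> 1 = 0"
proof (rule S_eqI)
  show "(T ^^ 1) 0 = 0" by (simp add: beta_map_def)
  fix x assume x: "0 \<le> x" "x < 1" "smallest_period \<beta> x 1"
  then have Tx: "T x = x" by (simp add: smallest_period_def)
  have "x = 0"
  proof (cases "x < q")
    case True
    then have "x = q * x" using digit_0[OF x(1)] Tx by simp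
    then show ?thesis using q_less_1 by simp
  next
    case False
    \<comment> \<open>The fixed point with digit \<open>1\<close> is \<open>q / (1 - q)\<close>, which is not below \<open>1\<close>.\<close>
    then have "x = q * (1 + x)" using digit_1[of x] x(2) Tx by simp
    then have "x * (1 - q) = q" by (simp add: algebra_simps)
    moreover have "x * (1 - q) \<le> 1 * (1 - q)"
      using x(2) q_less_1 by (intro mult_right_mono) auto
    ultimately show ?thesis using q_gt_half by simp
  qed
  then show "\<exists>n. (T ^^ n) x \<le> 0" by (intro exI[of _ 0]) simp
qed auto

end

text \<open>Uniqueness of the root: the difference of the equations for \<open>b\<close> and \<open>a\<close> is \<open>b - a\<close> times a
  factor that is positive for \<open>a, b > 1\<close>.\<close>

lemma tribonacci_number: "tribonacci tribonacci_number"
proof -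
  let ?P = "\<lambda>x::real. 1 < x \<and> x < 2 \<and> x ^ 3 = x ^ 2 + x + 1"
  have "\<exists>x\<ge>1. x \<le> 2 \<and> (x::real) ^ 3 - x ^ 2 - x = 1"
    by (rule IVT') (auto intro!: continuous_intros)
  then obtain a :: real where a: "1 \<le> a" "a \<le> 2" "a ^ 3 - a ^ 2 - a = 1" by blast
  moreover have "a \<noteq> 1" "a \<noteq> 2" using a(3) by auto
  ultimately have Pa: "?P a" by auto
  have "b = a" if "?P b" for b
  proof -
    have "(b - a) * (b^2 + a * b + a^2 - b - a - 1) = 0"
      using that Pa by (simp add: algebra_simps power2_eq_square power3_eq_cube)
    moreover have "0 < b^2 + a * b + a^2 - b - a - 1"
    proof -
      have "b * 1 < b * b" "a * 1 < a * a" "1 * 1 < a * b"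
        using that Pa by (intro mult_strict_left_mono mult_strict_mono; simp)+
      then show ?thesis by (simp add: power2_eq_square)
    qed
    ultimately show ?thesis by simp
  qed
  then have "tribonacci_number = a"
    unfolding tribonacci_number_def using Pa by (intro the_equality) blast+
  then show ?thesis using Pa by unfold_locales auto
qed

theorem theorem5p8:
  fixes \<beta> :: real
  assumes "\<beta> = tribonacci_number"
  shows "S \<beta> 1 = 0
    \<and> S \<beta> 3 = beta_value \<beta> (periodic_word [0,0,1])
    \<and> S \<beta> 4 = beta_value \<beta> (periodic_word [0,0,1,1])
    \<and> S \<beta> 6 = beta_value \<beta> (periodic_word [0,0,1,1,0,1])
    \<and> (\<forall>p m. p = 3 * m + 2 \<longrightarrow>
         S \<beta> p = beta_value \<beta> (periodic_word ([0,1] @ word_power [0,1,1] m)))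
    \<and> (\<forall>p m z. p = 3 * m + 1 \<and> m = 2 * z \<and> z \<ge> 1 \<longrightarrow>
         S \<beta> p = beta_value \<beta> (periodic_word
           ([0,1] @ word_power [0,1,1] (z - 1) @ [0,1] @ word_power [0,1,1] z)))
    \<and> (\<forall>p m z. p = 3 * m + 1 \<and> m = 2 * z + 1 \<and> z \<ge> 1 \<longrightarrow>
         S \<beta> p = beta_value \<beta> (periodic_word
           ([0,1] @ word_power [0,1,1] (z - 1) @ [0,1] @ word_power [0,1,1] (z + 1))))
    \<and> (\<forall>p m z. p = 3 * m \<and> m = 3 * z \<and> z \<ge> 1 \<longrightarrow>
         S \<beta> p = beta_value \<beta> (periodic_word
           ([0,1] @ word_power [0,1,1] (z - 1) @ [0,1] @ word_power [0,1,1] (z - 1)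
             @ [0,1] @ word_power [0,1,1] z)))
    \<and> (\<forall>p m z. p = 3 * m \<and> m = 3 * z + 1 \<and> z \<ge> 1 \<longrightarrow>
         S \<beta> p = beta_value \<beta> (periodic_word
           ([0,1] @ word_power [0,1,1] (z - 1) @ [0,1] @ word_power [0,1,1] z
             @ [0,1] @ word_power [0,1,1] z)))
    \<and> (\<forall>p m z. p = 3 * m \<and> m = 3 * z + 2 \<and> z \<ge> 1 \<longrightarrow>
         S \<beta> p = beta_value \<beta> (periodic_word
           ([0,1] @ word_power [0,1,1] (z - 1) @ [0,1] @ word_power [0,1,1] (z + 1)
             @ [0,1] @ word_power [0,1,1] z)))"
proof -
  interpret tribonacci \<beta>
    unfolding assms by (rule tribonacci_number)
  have one: "S \<beta> (3 * m + 2) = beta_value \<beta> (periodic_word ([0,1] @ word_power [0,1,1] m))" for m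
  proof -
    have "spell [m] = [0,1] @ word_power [0,1,1] m" by (simp add: spell_def)
    moreover have "length (spell [m]) = 3 * m + 2" by (simp add: length_spell)
    ultimately show ?thesis using S_one_gap[of m] by simp
  qed
  have two: "S \<beta> p = beta_value \<beta> (periodic_word
      ([0,1] @ word_power [0,1,1] h @ [0,1] @ word_power [0,1,1] b))"
    if "b = h + 1 \<or> b = h + 2" "p = 3 * (h + b) + 4" for p h b
  proof -
    have "spell [h,b] = [0,1] @ word_power [0,1,1] h @ [0,1] @ word_power [0,1,1] b"
      by (simp add: spell_def)
    moreover have "length (spell [h,b]) = p" using that(2) by (simp add: length_spell)
    ultimately show ?thesis using S_two_gaps[OF that(1)] by simp
  qed
  have three: "S \<beta> p = beta_value \<beta> (periodic_word
      ([0,1] @ word_power [0,1,1] h @ [0,1] @ word_power [0,1,1] b @ [0,1] @ word_power [0,1,1] c))"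
    if "(b, c) \<in> {(h, h + 1), (h + 1, h + 1), (h + 2, h + 1)}" "p = 3 * (h + b + c) + 6" for p h b c
  proof -
    have "spell [h,b,c]
        = [0,1] @ word_power [0,1,1] h @ [0,1] @ word_power [0,1,1] b @ [0,1] @ word_power [0,1,1] c"
      by (simp add: spell_def)
    moreover have "length (spell [h,b,c]) = p" using that(2) by (simp add: length_spell)
    ultimately show ?thesis using S_three_gaps[OF that(1)] by simp
  qed
  show ?thesis
  proof (intro conjI allI impI)
    fix p m z :: nat
    show "p = 3 * m + 2 \<Longrightarrow>
        S \<beta> p = beta_value \<beta> (periodic_word ([0,1] @ word_power [0,1,1] m))"
      using one[of m] by (simp only:)
    show "S \<beta> p = beta_value \<beta> (periodic_word
        ([0,1] @ word_power [0,1,1] (z - 1) @ [0,1] @ word_power [0,1,1] z))"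
      if "p = 3 * m + 1 \<and> m = 2 * z \<and> 1 \<le> z"
      by (rule two) (use that in auto)
    show "S \<beta> p = beta_value \<beta> (periodic_word
        ([0,1] @ word_power [0,1,1] (z - 1) @ [0,1] @ word_power [0,1,1] (z + 1)))"
      if "p = 3 * m + 1 \<and> m = 2 * z + 1 \<and> 1 \<le> z"
      by (rule two) (use that in auto)
    show "S \<beta> p = beta_value \<beta> (periodic_word
        ([0,1] @ word_power [0,1,1] (z - 1) @ [0,1] @ word_power [0,1,1] (z - 1)
          @ [0,1] @ word_power [0,1,1] z))"
      if "p = 3 * m \<and> m = 3 * z \<and> 1 \<le> z"
      by (rule three) (use that in auto)
    show "S \<beta> p = beta_value \<beta> (periodic_word
        ([0,1] @ word_power [0,1,1] (z - 1) @ [0,1] @ word_power [0,1,1] z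
          @ [0,1] @ word_power [0,1,1] z))"
      if "p = 3 * m \<and> m = 3 * z + 1 \<and> 1 \<le> z"
      by (rule three) (use that in auto)
    show "S \<beta> p = beta_value \<beta> (periodic_word
        ([0,1] @ word_power [0,1,1] (z - 1) @ [0,1] @ word_power [0,1,1] (z + 1)
          @ [0,1] @ word_power [0,1,1] z))"
      if "p = 3 * m \<and> m = 3 * z + 2 \<and> 1 \<le> z"
      by (rule three) (use that in auto)
  qed (rule S_1 S_3 S_4 S_6)+
qed

end
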